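(* Let $n\ge2$, $1\le k\le n$, $k'=n+1-k$, and for $b\in B^{k,\infty}$ and $i\in\{0,\dots,n\}$ let $\tilde s_i(b):=\tilde e_i^{-\mathrm{wt}_i(b)}(b)$ (the piecewise-linear action of the affine Weyl group $W(A_n^{(1)})$ on $B^{k,\infty}$). For $1\le i\le n$ let $\beta=\max(0,i-k')$, $\gamma=\min(k,i)$ and, for $p\in\{\beta+1,\dots,\gamma\}$ and $b=(b_{j,i})\in B^{k,\infty}$, $$\tilde\Gamma_i(p):=\sum_{p\le j\le\gamma}(b_{j,i}-b_{j+1,i+1}),$$ and set $\Delta^{(1)}_b(c):=\Delta_b(c)+b_{11}$, $\Delta^{(k)}_b(c):=\Delta_b(c)+b_{k,n+1}$ for $c\in C$. Then the action of $\tilde s_i$ is as follows, for $1\le l\le k$, $l\le m\le l+k'$: for $i=1,\dots,n$, $$\tilde s_i(b)_{l,m}=b_{l,m}+(\delta_{i,m-1}-\delta_{i,m})\times\Big(\min\Big(\min_{l+1\le p\le\gamma}\tilde\Gamma_i(p),\ \min_{\beta+1\le p\le l}\tilde\Gamma_i(p)\Big)-\min\Big(\min_{l\le p\le\gamma}\tilde\Gamma_i(p),\ \min_{\beta+1\le p\le l-1}\tilde\Gamma_i(p)\Big)\Big),$$ where $p$ runs over the elements of $\{\beta+1,\dots,\gamma\}$ satisfying the indicated inequalities, and $$\begin{aligned}\tilde s_0(b)_{l,m}=b_{l,m}&+\min\Big(\min_{c_{l-1}>m}\Delta^{(1)}_b(c),\min_{c_{l-1}\le m}\Delta^{(k)}_b(c)\Big)-\min\Big(\min_{c_l>m}\Delta^{(1)}_b(c),\min_{c_l\le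 m}\Delta^{(k)}_b(c)\Big)\\&+\min\Big(\min_{c_l\ge m}\Delta^{(1)}_b(c),\min_{c_l<m}\Delta^{(k)}_b(c)\Big)-\min\Big(\min_{c_{l-1}\ge m}\Delta^{(1)}_b(c),\min_{c_{l-1}<m}\Delta^{(k)}_b(c)\Big),\end{aligned}$$ where each inner minimum is over $c=(c_0,\dots,c_k)\in C$ satisfying the indicated condition. A minimum over an empty set is $+\infty$.
   Context: $B^{k,\infty}$ is the set of integer arrays $b=(b_{ji})_{1\le j\le k,\ j\le i\le j+k'}$ with $\sum_{i=j}^{j+k'}b_{ji}=0$ for every $j$; $b_{ji}=0$ outside this index range. Its $A_n^{(1)}$-crystal structure is as follows; $\tilde f_i=\tilde e_i^{-1}$, so $\tilde e_i^{-r}=\tilde f_i^{\,r}$, and $\mathrm{wt}_i=\varphi_i-\varepsilon_i$. Here $\delta$ is the Kronecker delta. For $1\le i\le n$: with $\beta=\max(0,i-k')$, $\gamma=\min(k,i)$ and $\Gamma_i(c)=\sum_{\beta<j<c}(b_{ji}-b_{j+1,i+1})$ for $\beta<c\le\gamma$, let $c_0$ (resp. $c_1$) be the smallest (resp. largest) integer $c\in(\beta,\gamma]$ at which $\Gamma_i$ attains its minimum. Then $$\varepsilon_i(b)=\sum_{\beta\le j<c_0}(b_{j+1,i+1}-b_{ji}),\quad \varphi_i(b)=\sum_{c_1\le j\le\gamma}(b_{ji}-b_{j+1,i+1}),$$ $\tilde e_i(b)_{pq}=b_{pq}-\delta_{p,c_0}\delta_{q,i+1}+\delta_{p,c_0}\delta_{q,i}$,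 $\tilde f_i(b)_{pq}=b_{pq}-\delta_{p,c_1}\delta_{q,i}+\delta_{p,c_1}\delta_{q,i+1}$. For $i=0$: $C=\{(c_0,\dots,c_k)\in\mathbb N^{k+1}:1=c_0<c_1<\dots<c_k=n+1\}$ with the componentwise partial order $\preceq$, and $\Delta_b(c)=\sum_{j=1}^k\sum_{c_{j-1}<i<c_j}b_{ji}$. There is a unique $c^{(e)}\in C$ with, for any $c\in C$, $\Delta_b(c^{(e)})\le\Delta_b(c)$ if $c^{(e)}\preceq c$ and $\Delta_b(c^{(e)})<\Delta_b(c)$ if $c^{(e)}\not\preceq c$, and a unique $c^{(f)}\in C$ with, for any $c\in C$, $\Delta_b(c^{(f)})\le\Delta_b(c)$ if $c\preceq c^{(f)}$ and $\Delta_b(c^{(f)})<\Delta_b(c)$ if $c\not\preceq c^{(f)}$. Then $\varepsilon_0(b)=-b_{k,n+1}-\Delta_b(c^{(e)})$, $\varphi_0(b)=-b_{11}-\Delta_b(c^{(f)})$, $\tilde e_0(b)_{ji}=b_{ji}-\delta_{i,c^{(e)}_{j-1}}+\delta_{i,c^{(e)}_j}$, $\tilde f_0(b)_{ji}=b_{ji}-\delta_{i,c^{(f)}_j}+\delta_{i,c^{(f)}_{j-1}}$.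
   Formalization: For 1≤i≤n the printed formula reduces to s̃_i(b)=b, which is false; the formal one has −Γ̃_i(p) in the minima over p≥l+1 and p≥l, and Σ_{β≤j<p}(b_{j,i}−b_{j+1,i+1}) in place of Γ̃_i(p) in those over p≤l and p≤l−1. *)

theory Defs
  imports "HOL-Library.Extended_Real"
begin

(* An array b = (b_{ji}) is a total function, b j i, that is 0 outside
   1 \<le> j \<le> k, j \<le> i \<le> j + k'.  Rows 0 and k + 1 do occur in the sums below
   and contribute 0. *)

type_synonym array = "nat \<Rightarrow> nat \<Rightarrow> int"

definition kc :: "nat \<Rightarrow> nat \<Rightarrow> nat" where
  "kc n k = n + 1 - k"

definition Binf :: "nat \<Rightarrow> nat \<Rightarrow> array set" where
  "Binf n k = {b.
     (\<forall>j i. \<not> (1 \<le> j \<and> j \<le> k \<and> j \<le> i \<and> i \<le> j + kc n k) \<longrightarrow> b j i = 0) \<and>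
     (\<forall>j\<in>{1..k}. (\<Sum>i=j..j + kc n k. b j i) = 0)}"

(* beta = max (0, i - k'): the maximum with 0 is the truncated subtraction on nat *)
definition beta :: "nat \<Rightarrow> nat \<Rightarrow> nat \<Rightarrow> nat" where
  "beta n k i = i - kc n k"

definition gam :: "nat \<Rightarrow> nat \<Rightarrow> nat" where
  "gam k i = min k i"


subsection \<open>Crystal structure, colours 1 to n\<close>

definition Gam :: "nat \<Rightarrow> nat \<Rightarrow> nat \<Rightarrow> array \<Rightarrow> nat \<Rightarrow> int" where
  "Gam n k i b c = (\<Sum>j\<in>{beta n k i<..<c}. b j i - b (j + 1) (i + 1))"

definition Gam_argmin :: "nat \<Rightarrow> nat \<Rightarrow> nat \<Rightarrow> array \<Rightarrow> nat \<Rightarrow> bool" where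
  "Gam_argmin n k i b c \<longleftrightarrow>
     c \<in> {beta n k i<..gam k i} \<and>
     (\<forall>c'\<in>{beta n k i<..gam k i}. Gam n k i b c \<le> Gam n k i b c')"

definition cmin :: "nat \<Rightarrow> nat \<Rightarrow> nat \<Rightarrow> array \<Rightarrow> nat" where
  "cmin n k i b = (LEAST c. Gam_argmin n k i b c)"

definition cmax :: "nat \<Rightarrow> nat \<Rightarrow> nat \<Rightarrow> array \<Rightarrow> nat" where
  "cmax n k i b = (GREATEST c. Gam_argmin n k i b c)"


subsection \<open>Crystal structure, colour 0\<close>

(* a sequence (c_0, ..., c_k) is the list of its k + 1 entries, c_j being c ! j *)
definition Cseq :: "nat \<Rightarrow> nat \<Rightarrow> nat list set" where
  "Cseq n k = {c. length c = k + 1 \<and> c ! 0 = 1 \<and> c ! k = n + 1 \<and>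
     (\<forall>j\<in>{1..k}. c ! (j - 1) < c ! j)}"

abbreviation preceq :: "nat list \<Rightarrow> nat list \<Rightarrow> bool" where
  "preceq c d \<equiv> list_all2 (\<le>) c d"

definition Delta :: "nat \<Rightarrow> array \<Rightarrow> nat list \<Rightarrow> int" where
  "Delta k b c = (\<Sum>j=1..k. \<Sum>i\<in>{c ! (j - 1)<..<c ! j}. b j i)"

definition ce :: "nat \<Rightarrow> nat \<Rightarrow> array \<Rightarrow> nat list" where
  "ce n k b = (THE c. c \<in> Cseq n k \<and>
     (\<forall>d\<in>Cseq n k. (preceq c d \<longrightarrow> Delta k b c \<le> Delta k b d) \<and>
                   (\<not> preceq c d \<longrightarrow> Delta k b c < Delta k b d)))"

definition cf :: "nat \<Rightarrow> nat \<Rightarrow> array \<Rightarrow> nat list" where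
  "cf n k b = (THE c. c \<in> Cseq n k \<and>
     (\<forall>d\<in>Cseq n k. (preceq d c \<longrightarrow> Delta k b c \<le> Delta k b d) \<and>
                   (\<not> preceq d c \<longrightarrow> Delta k b c < Delta k b d)))"


subsection \<open>The crystal and the operators s\<close>

definition eps :: "nat \<Rightarrow> nat \<Rightarrow> nat \<Rightarrow> array \<Rightarrow> int" where
  "eps n k i b =
     (if i = 0 then - b k (n + 1) - Delta k b (ce n k b)
      else (\<Sum>j\<in>{beta n k i..<cmin n k i b}. b (j + 1) (i + 1) - b j i))"

definition phi :: "nat \<Rightarrow> nat \<Rightarrow> nat \<Rightarrow> array \<Rightarrow> int" where
  "phi n k i b =
     (if i = 0 then - b 1 1 - Delta k b (cf n k b)
      else (\<Sum>j=cmax n k i b..gam k i. b j i - b (j + 1) (i + 1)))"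

definition wt :: "nat \<Rightarrow> nat \<Rightarrow> nat \<Rightarrow> array \<Rightarrow> int" where
  "wt n k i b = phi n k i b - eps n k i b"

definition et :: "nat \<Rightarrow> nat \<Rightarrow> nat \<Rightarrow> array \<Rightarrow> array" where
  "et n k i b = (\<lambda>p q.
     if i = 0 then
       (if p \<in> {1..k}
        then b p q - of_bool (q = ce n k b ! (p - 1)) + of_bool (q = ce n k b ! p)
        else b p q)
     else b p q - of_bool (p = cmin n k i b \<and> q = i + 1)
                + of_bool (p = cmin n k i b \<and> q = i))"

definition ft :: "nat \<Rightarrow> nat \<Rightarrow> nat \<Rightarrow> array \<Rightarrow> array" where
  "ft n k i b = (\<lambda>p q.
     if i = 0 then
       (if p \<in> {1..k}
        then b p q - of_bool (q = cf n k b ! p) + of_bool (q = cf n k b ! (p - 1))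
        else b p q)
     else b p q - of_bool (p = cmax n k i b \<and> q = i)
                + of_bool (p = cmax n k i b \<and> q = i + 1))"

(* the integer power of et, using that ft is inverse to et on Binf *)
definition et_pow :: "nat \<Rightarrow> nat \<Rightarrow> nat \<Rightarrow> int \<Rightarrow> array \<Rightarrow> array" where
  "et_pow n k i r =
     (if 0 \<le> r then et n k i ^^ nat r else ft n k i ^^ nat (- r))"

definition st :: "nat \<Rightarrow> nat \<Rightarrow> nat \<Rightarrow> array \<Rightarrow> array" where
  "st n k i b = et_pow n k i (- wt n k i b) b"


subsection \<open>The functions in the explicit formulas\<close>

(* GamR is the function written tilde Gamma_i in the source.  The source prints
   tilde Gamma_i(p) in all four inner minima of the formula for s_i, 1 \<le> i \<le> n.
   Each of the two outer minima then ranges over all of {beta + 1..gamma}, so that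
   their difference is 0 and the formula reads s_i(b) = b, which fails already for
   n = 2, k = 1, i = 1, where s_1 exchanges b_{11} and b_{12}.  The formula is
   therefore stated with - GamR in the minima over p > l and p \<ge> l, and with GamL
   in those over p \<le> l and p < l.  As GamL = wt_i - GamR, the two functions differ
   by wt_i(b), exactly as Delta1 and Deltak, which play the corresponding roles in
   the formula for s_0, differ by wt_0(b). *)

definition GamR :: "nat \<Rightarrow> nat \<Rightarrow> array \<Rightarrow> nat \<Rightarrow> int" where
  "GamR k i b p = (\<Sum>j=p..gam k i. b j i - b (j + 1) (i + 1))"

definition GamL :: "nat \<Rightarrow> nat \<Rightarrow> nat \<Rightarrow> array \<Rightarrow> nat \<Rightarrow> int" where
  "GamL n k i b p = (\<Sum>j\<in>{beta n k i..<p}. b j i - b (j + 1) (i + 1))"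

definition Delta1 :: "nat \<Rightarrow> array \<Rightarrow> nat list \<Rightarrow> int" where
  "Delta1 k b c = Delta k b c + b 1 1"

definition Deltak :: "nat \<Rightarrow> nat \<Rightarrow> array \<Rightarrow> nat list \<Rightarrow> int" where
  "Deltak n k b c = Delta k b c + b k (n + 1)"

definition ext :: "int \<Rightarrow> ereal" where
  "ext x = ereal (real_of_int x)"

(* minimum of f over a finite set; equal to \<infinity> if the set is empty *)
definition minover :: "'a set \<Rightarrow> ('a \<Rightarrow> int) \<Rightarrow> ereal" where
  "minover A f = (INF x\<in>A. ext (f x))"

end

(* The formulas interpolate: for r = wt_i(b) they read b + (differences of M_r), where M_r is the
   minimum of the energies with a penalty r on one side of a threshold.  One application of ft
   changes the energies so that M_(r+1)(b) = M_r(ft b) + [threshold not passed by the argmin],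
   whence ft^r is computed by M_r by induction on r.  For colour 0 the energy Delta is a separable
   function of the chain, hence modular on the lattice of chains and additive under cutting and
   regluing two chains; this controls it after ft.  Powers of et are treated in the same way for
   i > 0, and for i = 0 by a diagram symmetry. *)

theory Submission
  imports Defs
begin

text \<open>The exponent r stays free in the induction: the formula for the r-th power of an
  operator is proved for all arrays b at once, and wt_i(b) is inserted only at the end. There it
  splits one energy into the two functions of the statement, because \<open>- GamR\<close> is
  \<open>GamL\<close> minus wt_i and \<open>Deltak\<close> is \<open>Delta1\<close> plus wt_0. For i
  >= 1 the recursion is checked index by index: beyond the argmin all energies move by the same
  amount, and elsewhere the argmin itself is the witness. For colour 0 this breaks down: under
  \<open>ft\<close> a chain above \<open>cf\<close> loses as many units of energy as it has jumps
  over \<open>cf\<close>, and this number varies. Two facts replace the uniform change. Each jump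
  costs at least one unit beforehand, so no chain drops below the old minimum; and a chain above
  \<open>cf\<close> and beyond the threshold can be replaced by one with a single jump, still beyond
  the threshold, whose energy after \<open>ft\<close> is no larger. Modularity reduces an arbitrary
  chain to its join with \<open>cf\<close>.\<close>

subsection \<open>Minima over finite sets\<close>

lemma Min_image_attained:
  fixes h :: "'a \<Rightarrow> int"
  assumes "finite S" "S \<noteq> {}"
  obtains c where "c \<in> S" "h c = (MIN c\<in>S. h c)"
proof -
  have "(MIN c\<in>S. h c) \<in> h ` S" using assms by (intro Min_in) auto
  then show ?thesis using that by (metis imageE)
qed

text \<open>The witness \<open>d\<close> may be any function of \<open>c\<close>, with no bijection
  required: the energies before and after an operator differ by amounts that vary over
  \<open>S\<close>, and only their minima are related.\<close>

lemma Min_image_shiftI: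
  fixes g h :: "'a \<Rightarrow> int"
  assumes "finite S" "S \<noteq> {}"
    and "\<And>c. c \<in> S \<Longrightarrow> \<exists>d\<in>S. h d \<le> g c + t"
    and "\<And>c. c \<in> S \<Longrightarrow> \<exists>d\<in>S. g d + t \<le> h c"
  shows "(MIN c\<in>S. h c) = (MIN c\<in>S. g c) + t"
proof (rule antisym)
  obtain c where c: "c \<in> S" "g c = (MIN c\<in>S. g c)"
    using Min_image_attained[OF assms(1,2)] .
  with assms(3) obtain d where "d \<in> S" "h d \<le> g c + t" by blast
  moreover have "(MIN c\<in>S. h c) \<le> h d" using \<open>d \<in> S\<close> assms(1) by simp
  ultimately show "(MIN c\<in>S. h c) \<le> (MIN c\<in>S. g c) + t" using c by linarith
next
  obtain c where c: "c \<in> S" "h c = (MIN c\<in>S. h c)"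
    using Min_image_attained[OF assms(1,2)] .
  with assms(4) obtain d where "d \<in> S" "g d + t \<le> h c" by blast
  moreover have "(MIN c\<in>S. g c) \<le> g d" using \<open>d \<in> S\<close> assms(1) by simp
  ultimately show "(MIN c\<in>S. g c) + t \<le> (MIN c\<in>S. h c)" using c by linarith
qed

lemma ext_arith: "ext x + ext y = ext (x + y)" "ext x - ext y = ext (x - y)" "ext x * ext y = ext (x * y)"
  by (simp_all add: ext_def)

lemma minover_eq_Min:
  assumes "finite A" "A \<noteq> {}"
  shows "minover A f = ext (MIN x\<in>A. f x)"
proof -
  have "mono ext" by (simp add: mono_def ext_def)
  then have "ext (MIN x\<in>A. f x) = Min (ext ` f ` A)"
    using assms by (intro mono_Min_commute) auto
  also have "\<dots> = Inf (ext ` f ` A)"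
    using assms by (intro Min_Inf) auto
  finally show ?thesis by (simp add: minover_def image_image)
qed

text \<open>One of the two parts may be empty; its infinite minimum is then absorbed. The parts
  together exhaust the nonempty set \<open>S\<close>, so the extended-real expression is an integer
  minimum in disguise.\<close>

lemma min_minover:
  assumes "finite S" "S \<noteq> {}" and "\<And>c. c \<in> S \<Longrightarrow> Q c \<longleftrightarrow> \<not> P c"
  shows "min (minover {c \<in> S. P c} f) (minover {c \<in> S. Q c} g) =
         ext (MIN c\<in>S. if P c then f c else g c)"
proof -
  let ?h = "\<lambda>c. if P c then f c else g c"
  have "minover {c \<in> S. P c} f = minover {c \<in> S. P c} ?h"
    by (simp add: minover_def)
  moreover have "minover {c \<in> S. Q c} g = minover {c \<in> S. Q c} ?h"
    using assms(3) unfolding minover_def by (intro INF_cong) auto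
  moreover have "{c \<in> S. P c} \<union> {c \<in> S. Q c} = S" using assms(3) by auto
  moreover have "min (minover A ?h) (minover B ?h) = minover (A \<union> B) ?h" for A B
    by (simp only: minover_def INF_union inf_min)
  ultimately have "min (minover {c \<in> S. P c} f) (minover {c \<in> S. Q c} g) = minover S ?h"
    by (simp only:)
  then show ?thesis using assms(1,2) by (simp add: minover_eq_Min)
qed


subsection \<open>Colours 1 to n\<close>

locale colour =
  fixes n k i :: nat
  assumes k: "1 \<le> k" "k \<le> n" and i: "1 \<le> i" "i \<le> n"
begin

abbreviation "P \<equiv> {beta n k i<..gam k i}"

lemma P_nonempty: "P \<noteq> {}"
  using k i by (auto simp: beta_def gam_def kc_def)

text \<open>The extra summand at \<open>beta\<close> does not depend on \<open>p\<close>, so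
  \<open>Gam\<close> and \<open>GamL\<close> have the same minimisers.\<close>

lemma GamL_eq_Gam:
  assumes "p \<in> P"
  shows "GamL n k i b p = b (beta n k i) i - b (beta n k i + 1) (i + 1) + Gam n k i b p"
proof -
  have "{beta n k i..<p} = insert (beta n k i) {beta n k i<..<p}" using assms by auto
  then show ?thesis by (simp add: GamL_def Gam_def)
qed

lemma Gam_argmin_iff:
  "Gam_argmin n k i b c \<longleftrightarrow> c \<in> P \<and> (\<forall>p\<in>P. GamL n k i b c \<le> GamL n k i b p)"
  by (auto simp: Gam_argmin_def GamL_eq_Gam)

lemma Gam_argmin_exists: "\<exists>c. Gam_argmin n k i b c"
proof -
  obtain c where c: "c \<in> P" "GamL n k i b c = (MIN p\<in>P. GamL n k i b p)"
    using Min_image_attained[OF _ P_nonempty] finite_greaterThanAtMost .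
  show ?thesis unfolding Gam_argmin_iff using c by (intro exI[of _ c]) auto
qed

lemma Gam_argmin_bound: "\<forall>c. Gam_argmin n k i b c \<longrightarrow> c \<le> gam k i"
  by (simp add: Gam_argmin_def)

lemma cmax_argmin: "Gam_argmin n k i b (cmax n k i b)"
  unfolding cmax_def using GreatestI_ex_nat[OF Gam_argmin_exists] Gam_argmin_bound by blast

lemma cmin_argmin: "Gam_argmin n k i b (cmin n k i b)"
  unfolding cmin_def by (rule LeastI_ex[OF Gam_argmin_exists])

lemma cmax_in: "cmax n k i b \<in> P" and cmin_in: "cmin n k i b \<in> P"
  using cmax_argmin cmin_argmin by (auto simp: Gam_argmin_def)

lemma GamL_cmax_le: "p \<in> P \<Longrightarrow> GamL n k i b (cmax n k i b) \<le> GamL n k i b p"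
  using cmax_argmin by (simp add: Gam_argmin_iff)

lemma GamL_cmin_le: "p \<in> P \<Longrightarrow> GamL n k i b (cmin n k i b) \<le> GamL n k i b p"
  using cmin_argmin by (simp add: Gam_argmin_iff)

lemma GamL_cmax_less:
  assumes "p \<in> P" "cmax n k i b < p"
  shows "GamL n k i b (cmax n k i b) < GamL n k i b p"
proof (rule ccontr)
  assume "\<not> ?thesis"
  then have "Gam_argmin n k i b p"
    unfolding Gam_argmin_iff using assms(1) GamL_cmax_le[of _ b] by (smt (verit))
  then have "p \<le> cmax n k i b"
    unfolding cmax_def using Greatest_le_nat Gam_argmin_bound by blast
  then show False using assms by simp
qed

lemma GamL_cmin_less:
  assumes "p \<in> P" "p < cmin n k i b"
  shows "GamL n k i b (cmin n k i b) < GamL n k i b p"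
proof (rule ccontr)
  assume "\<not> ?thesis"
  then have "Gam_argmin n k i b p"
    unfolding Gam_argmin_iff using assms(1) GamL_cmin_le[of _ b] by (smt (verit))
  then have "cmin n k i b \<le> p"
    unfolding cmin_def by (rule Least_le)
  then show False using assms by simp
qed

text \<open>\<open>GamL\<close> and \<open>GamR\<close> at \<open>p\<close> add up to the full sum
  \<open>W\<close>. This is the weight because \<open>phi\<close> is \<open>GamR\<close> at
  \<open>cmax\<close>, \<open>- eps\<close> is \<open>GamL\<close> at \<open>cmin\<close>, and
  \<open>GamL\<close> takes the same minimal value at both.\<close>

lemma GamR_eq: "p \<in> P \<Longrightarrow> GamR k i b p = wt n k i b - GamL n k i b p"
proof -
  define W where "W = (\<Sum>j=beta n k i..gam k i. b j i - b (j + 1) (i + 1))"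
  have GamR: "GamR k i b p = W - GamL n k i b p" if "p \<in> P" for p
  proof -
    have "{beta n k i..gam k i} = {beta n k i..<p} \<union> {p..gam k i}" using that by auto
    then have "W = GamL n k i b p + GamR k i b p"
      unfolding W_def GamL_def GamR_def by (simp add: sum.union_disjoint ivl_disj_int)
    then show ?thesis by simp
  qed
  have "phi n k i b = GamR k i b (cmax n k i b)"
    using i by (simp add: phi_def GamR_def)
  moreover have "eps n k i b = - GamL n k i b (cmin n k i b)"
    using i by (simp add: eps_def GamL_def sum_negf[symmetric])
  moreover have "GamL n k i b (cmin n k i b) = GamL n k i b (cmax n k i b)"
    using GamL_cmax_le[OF cmin_in, of b b] GamL_cmin_le[OF cmax_in, of b b] by simp
  ultimately have "wt n k i b = W" using GamR[OF cmax_in] by (simp add: wt_def)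
  then show "p \<in> P \<Longrightarrow> ?thesis" using GamR by simp
qed

text \<open>Row \<open>c\<close> enters two summands: j = c through column i, and j = c - 1 through
  column i + 1. For p > c both are in range, for p = c only the second, for p < c neither. The
  values t = 1 and t = -1 give \<open>ft\<close> and \<open>et\<close>.\<close>

lemma GamL_unit_move:
  assumes "c \<in> P"
    and "\<And>j. b' j i = b j i - t * of_bool (j = c)"
    and "\<And>j. b' j (i + 1) = b j (i + 1) + t * of_bool (j = c)"
  shows "GamL n k i b' p = GamL n k i b p - t * (of_bool (c \<le> p) + of_bool (c < p))"
proof -
  have *: "j + 1 = c \<longleftrightarrow> j = c - 1" for j using assms(1) by auto
  have "GamL n k i b' p =
     (\<Sum>j\<in>{beta n k i..<p}. (b j i - b (j + 1) (i + 1))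
        - t * (of_bool (j = c) + of_bool (j = c - 1)))"
    unfolding GamL_def by (simp only: assms(2,3) *) (simp add: algebra_simps)
  also have "\<dots> = GamL n k i b p
      - t * (\<Sum>j\<in>{beta n k i..<p}. of_bool (j = c) + of_bool (j = c - 1))"
    by (simp add: GamL_def sum_subtractf sum_distrib_left)
  also have "(\<Sum>j\<in>{beta n k i..<p}. of_bool (j = c) + of_bool (j = c - 1)) =
      of_bool (c < p) + (of_bool (c \<le> p) :: int)"
  proof -
    have "c - 1 \<in> {beta n k i..<p} \<longleftrightarrow> c \<le> p" "c \<in> {beta n k i..<p} \<longleftrightarrow> c < p"
      using assms(1) by auto
    then show ?thesis
      by (simp add: sum.distrib of_bool_def sum.delta del: atLeastLessThan_iff)
  qed
  finally show ?thesis by (simp add: algebra_simps)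
qed

lemma GamL_ft:
  "GamL n k i (ft n k i b) p =
   GamL n k i b p - (of_bool (cmax n k i b \<le> p) + of_bool (cmax n k i b < p))"
  using GamL_unit_move[OF cmax_in, of "ft n k i b" b 1 b] i by (simp add: ft_def)

lemma GamL_et:
  "GamL n k i (et n k i b) p =
   GamL n k i b p + (of_bool (cmin n k i b \<le> p) + of_bool (cmin n k i b < p))"
  using GamL_unit_move[OF cmin_in, of "et n k i b" b "-1" b] i by (simp add: et_def)

section \<open>Penalised minima for the colours 1 to n\<close>

definition MG :: "int \<Rightarrow> array \<Rightarrow> nat \<Rightarrow> int" where
  "MG r b l = (MIN p\<in>P. GamL n k i b p - (if l < p then r else 0))"

lemma MG_0: "MG 0 b l = MG 0 b l'"
  by (simp add: MG_def)

text \<open>\<open>cmax\<close> is a minimiser after \<open>ft\<close> as well: it falls by one, and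
  the indices to its right, which fall by two, were larger by at least one. Hence
  \<open>cmax\<close> serves as witness unless the threshold separates it from a larger
  \<open>p\<close>; then \<open>p\<close> itself serves, its loss of two being matched by the change
  of penalty and the indicator.\<close>

lemma MG_ft:
  assumes "0 \<le> r"
  shows "MG (r + 1) b l = MG r (ft n k i b) l + of_bool (cmax n k i b \<le> l)"
  unfolding MG_def
proof (rule Min_image_shiftI[OF _ P_nonempty])
  let ?c = "cmax n k i b"
  fix p assume p: "p \<in> P"
  note facts = GamL_cmax_le[OF p, of b] GamL_cmax_less[OF p, of b] GamL_ft assms
  show "\<exists>d\<in>P. GamL n k i b d - (if l < d then r + 1 else 0) \<le>
      GamL n k i (ft n k i b) p - (if l < p then r else 0) + of_bool (?c \<le> l)"
  proof (cases "?c \<le> l \<and> l < p")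
    case True
    then show ?thesis using p facts by (intro bexI[of _ p]) auto
  next
    case False
    then show ?thesis using p facts
      by (intro bexI[OF _ cmax_in]) (auto split: if_splits)
  qed
  show "\<exists>d\<in>P. GamL n k i (ft n k i b) d - (if l < d then r else 0) + of_bool (?c \<le> l) \<le>
      GamL n k i b p - (if l < p then r + 1 else 0)"
  proof (cases "?c \<le> l \<and> l < p")
    case True
    then show ?thesis using p facts by (intro bexI[of _ p]) auto
  next
    case False
    then show ?thesis using p facts
      by (intro bexI[OF _ cmax_in]) (auto split: if_splits)
  qed
qed simp

text \<open>Mirror image of \<open>MG_ft\<close>: the smallest minimiser stays minimal because
  indices to its left are strictly larger and do not move, while it rises by one and those to its
  right by two.\<close>

lemma MG_et:
  assumes "0 \<le> r"
  shows "MG (- (r + 1)) b l = MG (- r) (et n k i b) l - of_bool (cmin n k i b \<le> l)"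
  unfolding MG_def diff_conv_add_uminus[of _ "of_bool _"]
proof (rule Min_image_shiftI[OF _ P_nonempty])
  let ?c = "cmin n k i b"
  fix p assume p: "p \<in> P"
  note facts = GamL_cmin_le[OF p, of b] GamL_cmin_less[OF p, of b] GamL_et assms
  show "\<exists>d\<in>P. GamL n k i b d - (if l < d then - (r + 1) else 0) \<le>
      GamL n k i (et n k i b) p - (if l < p then - r else 0) + - of_bool (?c \<le> l)"
  proof (cases "p \<le> l \<and> l < ?c")
    case True
    then show ?thesis using p facts by (intro bexI[of _ p]) auto
  next
    case False
    then show ?thesis using p facts
      by (intro bexI[OF _ cmin_in]) (auto split: if_splits)
  qed
  show "\<exists>d\<in>P. GamL n k i (et n k i b) d - (if l < d then - r else 0) + - of_bool (?c \<le> l) \<le>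
      GamL n k i b p - (if l < p then - (r + 1) else 0)"
  proof (cases "p \<le> l \<and> l < ?c")
    case True
    then show ?thesis using p facts by (intro bexI[of _ p]) auto
  next
    case False
    then show ?thesis using p facts
      by (intro bexI[OF _ cmin_in]) (auto split: if_splits)
  qed
qed simp

text \<open>Row \<open>l\<close> changes exactly when \<open>l\<close> is the argmin, and this
  indicator is the difference of the threshold indicators at \<open>l\<close> and
  \<open>l - 1\<close>, which is what \<open>MG_ft\<close> produces at each step.\<close>

lemma ft_pow:
  assumes "1 \<le> l"
  shows "(ft n k i ^^ r) b l m =
    b l m + (of_bool (m = i + 1) - of_bool (m = i)) * (MG (int r) b l - MG (int r) b (l - 1))"
proof (induction r arbitrary: b)
  case 0
  then show ?case using MG_0[of b l "l - 1"] by simp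
next
  case (Suc r)
  have "of_bool (l = cmax n k i b) =
      of_bool (cmax n k i b \<le> l) - (of_bool (cmax n k i b \<le> l - 1) :: int)"
    using assms by auto
  then have MG_diff: "MG (int (Suc r)) b l - MG (int (Suc r)) b (l - 1) =
      MG (int r) (ft n k i b) l - MG (int r) (ft n k i b) (l - 1) + of_bool (l = cmax n k i b)"
    using MG_ft[of "int r" b] by (simp add: add.commute)
  have elem: "ft n k i b l m =
      b l m + (of_bool (m = i + 1) - of_bool (m = i)) * of_bool (l = cmax n k i b)"
    using i by (auto simp: ft_def)
  show ?case
    unfolding funpow_Suc_right comp_apply Suc[of "ft n k i b"] MG_diff elem
    by (simp only: algebra_simps)
qed

lemma et_pow:
  assumes "1 \<le> l"
  shows "(et n k i ^^ r) b l m =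
    b l m + (of_bool (m = i + 1) - of_bool (m = i)) *
      (MG (- int r) b l - MG (- int r) b (l - 1))"
proof (induction r arbitrary: b)
  case 0
  then show ?case using MG_0[of b l "l - 1"] by simp
next
  case (Suc r)
  have "of_bool (l = cmin n k i b) =
      of_bool (cmin n k i b \<le> l) - (of_bool (cmin n k i b \<le> l - 1) :: int)"
    using assms by auto
  then have MG_diff: "MG (- int (Suc r)) b l - MG (- int (Suc r)) b (l - 1) =
      MG (- int r) (et n k i b) l - MG (- int r) (et n k i b) (l - 1)
      - of_bool (l = cmin n k i b)"
    using MG_et[of "int r" b] by (simp add: add.commute)
  have elem: "et n k i b l m =
      b l m - (of_bool (m = i + 1) - of_bool (m = i)) * of_bool (l = cmin n k i b)"
    using i by (auto simp: et_def)
  show ?case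
    unfolding funpow_Suc_right comp_apply Suc[of "et n k i b"] MG_diff elem
    by (simp only: algebra_simps)
qed

lemma st_eq:
  assumes "1 \<le> l"
  shows "st n k i b l m = b l m + (of_bool (m = i + 1) - of_bool (m = i)) *
    (MG (wt n k i b) b l - MG (wt n k i b) b (l - 1))"
proof (cases "0 \<le> - wt n k i b")
  case True
  then show ?thesis
    using et_pow[OF assms, of "nat (- wt n k i b)" b m] by (simp add: st_def et_pow_def)
next
  case False
  then show ?thesis
    using ft_pow[OF assms, of "nat (wt n k i b)" b m] by (simp add: st_def et_pow_def)
qed

text \<open>At r = wt_i the penalty in \<open>MG\<close> turns \<open>GamL\<close> into
  \<open>- GamR\<close> beyond the threshold. \<open>Q\<close> and \<open>R\<close> are abstract
  because the formula writes the thresholds \<open>l\<close> and \<open>l - 1\<close> in different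
  shapes.\<close>

lemma min_minover_MG:
  assumes "\<And>p. Q p \<longleftrightarrow> l < p" "\<And>p. R p \<longleftrightarrow> p \<le> l"
  shows "min (minover {p \<in> {beta n k i + 1..gam k i}. Q p} (\<lambda>p. - GamR k i b p))
             (minover {p \<in> {beta n k i + 1..gam k i}. R p} (GamL n k i b)) =
         ext (MG (wt n k i b) b l)"
proof -
  have P: "{beta n k i + 1..gam k i} = P" by auto
  have "(MIN p\<in>P. if l < p then - GamR k i b p else GamL n k i b p) = MG (wt n k i b) b l"
    unfolding MG_def by (intro arg_cong[of _ _ Min] image_cong) (auto simp: GamR_eq)
  moreover have "min (minover {p \<in> P. l < p} (\<lambda>p. - GamR k i b p))
      (minover {p \<in> P. p \<le> l} (GamL n k i b)) =
      ext (MIN p\<in>P. if l < p then - GamR k i b p else GamL n k i b p)"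
    using P_nonempty by (intro min_minover) (simp_all add: not_less)
  ultimately show ?thesis unfolding P assms by simp
qed

lemma ext_st:
  assumes "1 \<le> l" "1 \<le> m"
  shows "ext (st n k i b l m) =
    ext (b l m) + ext (of_bool (i = m - 1) - of_bool (i = m)) *
      (min (minover {p \<in> {beta n k i + 1..gam k i}. l + 1 \<le> p} (\<lambda>p. - GamR k i b p))
           (minover {p \<in> {beta n k i + 1..gam k i}. p \<le> l} (GamL n k i b))
       - min (minover {p \<in> {beta n k i + 1..gam k i}. l \<le> p} (\<lambda>p. - GamR k i b p))
             (minover {p \<in> {beta n k i + 1..gam k i}. p \<le> l - 1} (GamL n k i b)))"
proof -
  have of_bool: "of_bool (i = m - 1) - of_bool (i = m) = (of_bool (m = i + 1) - of_bool (m = i) :: int)"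
    using assms i by auto
  have "l + 1 \<le> p \<longleftrightarrow> l < p" "l \<le> p \<longleftrightarrow> l - 1 < p" for p using assms by auto
  note min_minover_MG[of "\<lambda>p. l + 1 \<le> p" l "\<lambda>p. p \<le> l", OF this(1) refl]
    min_minover_MG[of "\<lambda>p. l \<le> p" "l - 1" "\<lambda>p. p \<le> l - 1", OF this(2) refl]
  then show ?thesis
    by (simp only: st_eq[OF assms(1)] of_bool ext_arith)
qed

end

subsection \<open>Chains and the energy of colour 0\<close>

lemma CseqI:
  assumes "h 0 = 1" "h k = n + 1" "\<And>j. 1 \<le> j \<Longrightarrow> j \<le> k \<Longrightarrow> h (j - 1) < h j"
  shows "map h [0..<Suc k] \<in> Cseq n k"
  using assms by (auto simp: Cseq_def nth_map simp del: upt_Suc)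

lemma Cseq_lessI: "c \<in> Cseq n k \<Longrightarrow> 1 \<le> j \<Longrightarrow> j \<le> k \<Longrightarrow> c ! (j - 1) < c ! j"
  by (simp add: Cseq_def)

lemma Cseq_mono:
  assumes "c \<in> Cseq n k" "i \<le> j" "j \<le> k"
  shows "c ! i \<le> c ! j"
  using assms(2,3)
proof (induction j rule: dec_induct)
  case (step j)
  then show ?case using Cseq_lessI[OF assms(1), of "Suc j"] by simp
qed simp

lemma Cseq_bounds:
  assumes "c \<in> Cseq n k" "j \<le> k"
  shows "1 \<le> c ! j" "c ! j \<le> n + 1"
  using Cseq_mono[OF assms(1), of 0 j] Cseq_mono[OF assms(1), of j k] assms
  by (auto simp: Cseq_def)

lemma Cseq_eqI:
  "c \<in> Cseq n k \<Longrightarrow> d \<in> Cseq n k \<Longrightarrow> (\<And>j. j \<le> k \<Longrightarrow> c ! j = d ! j) \<Longrightarrow> c = d"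
  by (intro nth_equalityI) (auto simp: Cseq_def)

lemma finite_Cseq: "finite (Cseq n k)"
proof (rule finite_subset)
  show "Cseq n k \<subseteq> {xs. set xs \<subseteq> {..n + 1} \<and> length xs = k + 1}"
  proof
    fix c assume c: "c \<in> Cseq n k"
    then have "length c = k + 1" by (simp add: Cseq_def)
    then show "c \<in> {xs. set xs \<subseteq> {..n + 1} \<and> length xs = k + 1}"
      using Cseq_bounds(2)[OF c] by (auto simp: set_conv_nth)
  qed
  show "finite {xs. set xs \<subseteq> {..n + 1} \<and> length xs = k + 1}"
    by (rule finite_lists_length_eq) simp
qed

lemma Cseq_nonempty:
  assumes "1 \<le> k" "k \<le> n"
  shows "Cseq n k \<noteq> {}"
proof -
  have "map (\<lambda>j. if j = k then n + 1 else j + 1) [0..<Suc k] \<in> Cseq n k"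
    by (rule CseqI) (use assms in auto)
  then show ?thesis by blast
qed

lemma preceq_Cseq:
  assumes "c \<in> Cseq n k" "d \<in> Cseq n k"
  shows "preceq c d \<longleftrightarrow> (\<forall>j\<le>k. c ! j \<le> d ! j)"
  using assms by (auto simp: Cseq_def list_all2_conv_all_nth less_Suc_eq_le)

text \<open>As a chain increases strictly, each inner sum is a difference of prefix sums, so that
  neighbouring entries no longer interact.\<close>

lemma Delta_separable:
  assumes "c \<in> Cseq n k"
  shows "Delta k b c =
    (\<Sum>j=1..k. (\<Sum>i<c ! j. b j i) - (\<Sum>i\<le>c ! (j - 1). b j i))"
  unfolding Delta_def
proof (rule sum.cong[OF refl])
  fix j assume "j \<in> {1..k}"
  then have "c ! (j - 1) < c ! j" using Cseq_lessI[OF assms] by simp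
  then have "{..<c ! j} = {..c ! (j - 1)} \<union> {c ! (j - 1)<..<c ! j}" by auto
  then have "(\<Sum>i<c ! j. b j i) =
      (\<Sum>i\<le>c ! (j - 1). b j i) + (\<Sum>i\<in>{c ! (j - 1)<..<c ! j}. b j i)"
    by (simp add: sum.union_disjoint ivl_disj_int)
  then show "(\<Sum>i\<in>{c ! (j - 1)<..<c ! j}. b j i) =
      (\<Sum>i<c ! j. b j i) - (\<Sum>i\<le>c ! (j - 1). b j i)" by simp
qed

text \<open>A sum of functions of single entries keeps its total when two chains swap entries at any
  set of positions, as long as the results are chains. Join and meet are one instance, cutting at a
  jump is another.\<close>

lemma Delta_exchange:
  assumes C: "p \<in> Cseq n k" "q \<in> Cseq n k" "c \<in> Cseq n k" "d \<in> Cseq n k"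
    and ex: "\<And>j. j \<le> k \<Longrightarrow> p ! j = c ! j \<and> q ! j = d ! j \<or> p ! j = d ! j \<and> q ! j = c ! j"
  shows "Delta k b p + Delta k b q = Delta k b c + Delta k b d"
  unfolding C[THEN Delta_separable] sum.distrib[symmetric]
proof (rule sum.cong[OF refl])
  fix j assume "j \<in> {1..k}"
  then have "j \<le> k" "j - 1 \<le> k" by auto
  from this[THEN ex] show
    "(\<Sum>i<p ! j. b j i) - (\<Sum>i\<le>p ! (j - 1). b j i) +
       ((\<Sum>i<q ! j. b j i) - (\<Sum>i\<le>q ! (j - 1). b j i)) =
     (\<Sum>i<c ! j. b j i) - (\<Sum>i\<le>c ! (j - 1). b j i) +
       ((\<Sum>i<d ! j. b j i) - (\<Sum>i\<le>d ! (j - 1). b j i))"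
    by (elim disjE conjE) simp_all
qed

section \<open>The lattice of chains and the extremal minimisers\<close>

definition cjoin :: "nat \<Rightarrow> nat list \<Rightarrow> nat list \<Rightarrow> nat list" where
  "cjoin k c d = map (\<lambda>j. max (c ! j) (d ! j)) [0..<Suc k]"

definition cmeet :: "nat \<Rightarrow> nat list \<Rightarrow> nat list \<Rightarrow> nat list" where
  "cmeet k c d = map (\<lambda>j. min (c ! j) (d ! j)) [0..<Suc k]"

lemma cjoin_nth: "j \<le> k \<Longrightarrow> cjoin k c d ! j = max (c ! j) (d ! j)"
  by (simp add: cjoin_def nth_map del: upt_Suc)

lemma cmeet_nth: "j \<le> k \<Longrightarrow> cmeet k c d ! j = min (c ! j) (d ! j)"
  by (simp add: cmeet_def nth_map del: upt_Suc)

lemma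
  assumes "c \<in> Cseq n k" "d \<in> Cseq n k"
  shows cjoin_Cseq: "cjoin k c d \<in> Cseq n k"
    and cmeet_Cseq: "cmeet k c d \<in> Cseq n k"
proof -
  have "c ! 0 = 1" "d ! 0 = 1" "c ! k = n + 1" "d ! k = n + 1"
    using assms by (simp_all add: Cseq_def)
  moreover have "max (c ! (j - 1)) (d ! (j - 1)) < max (c ! j) (d ! j)"
      "min (c ! (j - 1)) (d ! (j - 1)) < min (c ! j) (d ! j)" if "1 \<le> j" "j \<le> k" for j
    using Cseq_lessI[OF assms(1) that] Cseq_lessI[OF assms(2) that] by linarith+
  ultimately show "cjoin k c d \<in> Cseq n k" "cmeet k c d \<in> Cseq n k"
    unfolding cjoin_def cmeet_def by (simp_all add: CseqI del: upt_Suc)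
qed

lemma Delta_modular:
  assumes "c \<in> Cseq n k" "d \<in> Cseq n k"
  shows "Delta k b (cjoin k c d) + Delta k b (cmeet k c d) = Delta k b c + Delta k b d"
  using assms
  by (intro Delta_exchange[of _ n]) (auto simp: cjoin_Cseq cmeet_Cseq cjoin_nth cmeet_nth max_def min_def)

definition is_cf :: "nat \<Rightarrow> nat \<Rightarrow> array \<Rightarrow> nat list \<Rightarrow> bool" where
  "is_cf n k b c \<longleftrightarrow> c \<in> Cseq n k \<and>
     (\<forall>d\<in>Cseq n k. (preceq d c \<longrightarrow> Delta k b c \<le> Delta k b d) \<and>
                   (\<not> preceq d c \<longrightarrow> Delta k b c < Delta k b d))"

definition is_ce :: "nat \<Rightarrow> nat \<Rightarrow> array \<Rightarrow> nat list \<Rightarrow> bool" where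
  "is_ce n k b c \<longleftrightarrow> c \<in> Cseq n k \<and>
     (\<forall>d\<in>Cseq n k. (preceq c d \<longrightarrow> Delta k b c \<le> Delta k b d) \<and>
                   (\<not> preceq c d \<longrightarrow> Delta k b c < Delta k b d))"

lemma preceq_antisym: "preceq c d \<Longrightarrow> preceq d c \<Longrightarrow> c = (d :: nat list)"
  by (rule nth_equalityI) (auto simp: list_all2_conv_all_nth intro: le_antisym)

lemma is_cf_preceq:
  assumes "is_cf n k b c" "is_cf n k b d"
  shows "preceq c d"
proof (rule ccontr)
  assume "\<not> preceq c d"
  then have "Delta k b d < Delta k b c" using assms by (simp add: is_cf_def)
  moreover have "Delta k b c \<le> Delta k b d"
    using assms by (cases "preceq d c") (auto simp: is_cf_def less_imp_le)
  ultimately show False by simp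
qed

lemma cf_eqI: "is_cf n k b c \<Longrightarrow> cf n k b = c"
  unfolding cf_def is_cf_def[symmetric]
  by (rule the_equality) (auto intro: preceq_antisym is_cf_preceq)

lemma is_ce_preceq:
  assumes "is_ce n k b c" "is_ce n k b d"
  shows "preceq c d"
proof (rule ccontr)
  assume "\<not> preceq c d"
  then have "Delta k b c < Delta k b d" using assms by (simp add: is_ce_def)
  moreover have "Delta k b d \<le> Delta k b c"
    using assms by (cases "preceq d c") (auto simp: is_ce_def less_imp_le)
  ultimately show False by simp
qed

lemma ce_eqI: "is_ce n k b c \<Longrightarrow> ce n k b = c"
  unfolding ce_def is_ce_def[symmetric]
  by (rule the_equality) (auto intro: preceq_antisym is_ce_preceq)

text \<open>By modularity the minimisers are closed under join, so a greatest one exists. It is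
  picked as a minimiser with the largest sum of entries: joining it with a minimiser not below it
  would increase that sum.\<close>

lemma is_cf_exists:
  assumes "1 \<le> k" "k \<le> n"
  shows "\<exists>c. is_cf n k b c"
proof -
  define A where "A = {c \<in> Cseq n k. \<forall>d\<in>Cseq n k. Delta k b c \<le> Delta k b d}"
  have "Min (Delta k b ` Cseq n k) \<in> Delta k b ` Cseq n k"
    using finite_Cseq Cseq_nonempty[OF assms] by (intro Min_in) auto
  then obtain a where a: "a \<in> Cseq n k" "Delta k b a = Min (Delta k b ` Cseq n k)" by auto
  then have "a \<in> A" using finite_Cseq[of n k] by (auto simp: A_def)
  have "finite A" using finite_Cseq[of n k] by (simp add: A_def)
  have "Max ((\<lambda>c. \<Sum>j\<le>k. c ! j) ` A) \<in> (\<lambda>c. \<Sum>j\<le>k. c ! j) ` A"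
    using \<open>finite A\<close> \<open>a \<in> A\<close> by (intro Max_in) auto
  then obtain c where c: "c \<in> A"
    and c_max: "(\<Sum>j\<le>k. c ! j) = Max ((\<lambda>c. \<Sum>j\<le>k. c ! j) ` A)" by auto
  have c': "c \<in> Cseq n k" "\<And>d. d \<in> Cseq n k \<Longrightarrow> Delta k b c \<le> Delta k b d"
    using c by (auto simp: A_def)
  have "preceq d c" if d: "d \<in> A" for d
  proof (rule ccontr)
    have d': "d \<in> Cseq n k" using d by (simp add: A_def)
    assume "\<not> preceq d c"
    then obtain j where j: "j \<le> k" "c ! j < d ! j"
      using preceq_Cseq[OF d' c'(1)] by (auto simp: not_le)
    have "Delta k b (cjoin k d c) \<le> Delta k b d"
      using Delta_modular[OF d' c'(1), of b] c'(2)[OF cmeet_Cseq[OF d' c'(1)]] by simp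
    then have "cjoin k d c \<in> A"
      using cjoin_Cseq[OF d' c'(1)] d by (force simp: A_def)
    then have "(\<Sum>j\<le>k. cjoin k d c ! j) \<le> (\<Sum>j\<le>k. c ! j)"
      using \<open>finite A\<close> by (simp add: c_max)
    moreover have "(\<Sum>j\<le>k. c ! j) < (\<Sum>j\<le>k. cjoin k d c ! j)"
      using j by (intro sum_strict_mono_ex1) (auto simp: cjoin_nth intro!: bexI[of _ j])
    ultimately show False by simp
  qed
  then have "Delta k b c < Delta k b d" if "d \<in> Cseq n k" "\<not> preceq d c" for d
    using that c' unfolding A_def by (smt (verit) mem_Collect_eq)
  then have "is_cf n k b c" using c' by (auto simp: is_cf_def)
  then show ?thesis ..
qed

section \<open>Energies of chains after one \<open>ft\<close> of colour 0\<close>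

locale colour0 =
  fixes n k :: nat
  assumes k: "1 \<le> k" "k \<le> n"
begin

lemma is_cf_cf: "is_cf n k b (cf n k b)"
  using is_cf_exists[OF k] cf_eqI by metis

lemma cf_Cseq: "cf n k b \<in> Cseq n k"
  using is_cf_cf by (simp add: is_cf_def)

lemma Delta_cf_le: "c \<in> Cseq n k \<Longrightarrow> Delta k b (cf n k b) \<le> Delta k b c"
  using is_cf_cf[of b] unfolding is_cf_def by (metis order_less_imp_le)

lemma Delta_cf_less:
  assumes "c \<in> Cseq n k" "j \<le> k" "cf n k b ! j < c ! j"
  shows "Delta k b (cf n k b) < Delta k b c"
proof -
  have "\<not> preceq c (cf n k b)"
    using assms preceq_Cseq[OF assms(1) cf_Cseq, of b] by (auto simp: not_le)
  then show ?thesis using is_cf_cf[of b] assms(1) by (simp add: is_cf_def)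
qed

lemma Delta_ft:
  assumes "c \<in> Cseq n k"
  shows "Delta k (ft n k 0 b) c = Delta k b c +
    (\<Sum>j=1..k. of_bool (cf n k b ! (j - 1) \<in> {c ! (j - 1)<..<c ! j})
             - of_bool (cf n k b ! j \<in> {c ! (j - 1)<..<c ! j}))"
  unfolding Delta_def sum.distrib[symmetric]
proof (rule sum.cong[OF refl])
  fix j assume j: "j \<in> {1..k}"
  have delta: "(\<Sum>i\<in>{c ! (j - 1)<..<c ! j}. of_bool (i = x)) =
      (of_bool (x \<in> {c ! (j - 1)<..<c ! j}) :: int)" for x
    by (simp add: of_bool_def del: greaterThanLessThan_iff)
  show "(\<Sum>i\<in>{c ! (j - 1)<..<c ! j}. ft n k 0 b j i) =
     (\<Sum>i\<in>{c ! (j - 1)<..<c ! j}. b j i) +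
     (of_bool (cf n k b ! (j - 1) \<in> {c ! (j - 1)<..<c ! j})
       - of_bool (cf n k b ! j \<in> {c ! (j - 1)<..<c ! j}))"
    using j unfolding ft_def delta[symmetric] by (simp add: sum.distrib sum_subtractf)
qed

text \<open>At a jump the unit that \<open>ft\<close> takes out of row \<open>j\<close> lies
  strictly inside a gap of \<open>c\<close> and lowers its energy. It is also a place where
  \<open>c\<close> can be cut: \<open>c\<close> before \<open>j\<close> followed by
  \<open>cf\<close> from \<open>j\<close> on is again a chain.\<close>

definition jumps :: "array \<Rightarrow> nat list \<Rightarrow> nat set" where
  "jumps b c = {j \<in> {1..k}. c ! (j - 1) < cf n k b ! j \<and> cf n k b ! j < c ! j}"

text \<open>For a chain above \<open>cf\<close>, the unit added in row \<open>j\<close> at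
  \<open>cf ! (j - 1)\<close> never lies beyond \<open>c ! (j - 1)\<close>, hence is not counted;
  only removed units contribute.\<close>

lemma Delta_ft_above:
  assumes "c \<in> Cseq n k" "\<And>j. j \<le> k \<Longrightarrow> cf n k b ! j \<le> c ! j"
  shows "Delta k (ft n k 0 b) c = Delta k b c - int (card (jumps b c))"
proof -
  have "(\<Sum>j=1..k. of_bool (cf n k b ! (j - 1) \<in> {c ! (j - 1)<..<c ! j})
             - of_bool (cf n k b ! j \<in> {c ! (j - 1)<..<c ! j})) =
      (\<Sum>j=1..k. - (of_bool (j \<in> jumps b c) :: int))"
    using assms(2) by (intro sum.cong) (auto simp: jumps_def not_less)
  also have "\<dots> = - int (card (jumps b c))"
  proof -
    have "{1..k} \<inter> jumps b c = jumps b c" by (auto simp: jumps_def)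
    then show ?thesis by (simp add: sum_negf of_bool_def sum.If_cases)
  qed
  finally show ?thesis using Delta_ft[OF assms(1), of b] by simp
qed

text \<open>For a chain below \<open>cf\<close> it is the removed units that are never counted, so
  its energy cannot fall.\<close>

lemma Delta_ft_below:
  assumes "c \<in> Cseq n k" "\<And>j. j \<le> k \<Longrightarrow> c ! j \<le> cf n k b ! j"
  shows "Delta k b c \<le> Delta k (ft n k 0 b) c"
proof -
  have "0 \<le> (\<Sum>j=1..k. of_bool (cf n k b ! (j - 1) \<in> {c ! (j - 1)<..<c ! j})
             - (of_bool (cf n k b ! j \<in> {c ! (j - 1)<..<c ! j}) :: int))"
  proof (rule sum_nonneg)
    fix j assume "j \<in> {1..k}"
    then have "c ! j \<le> cf n k b ! j" using assms(2) by simp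
    then show "0 \<le> of_bool (cf n k b ! (j - 1) \<in> {c ! (j - 1)<..<c ! j})
             - (of_bool (cf n k b ! j \<in> {c ! (j - 1)<..<c ! j}) :: int)" by simp
  qed
  then show ?thesis using Delta_ft[OF assms(1), of b] by simp
qed

text \<open>The first position where \<open>c\<close> exceeds \<open>cf\<close> is a jump, since the
  two chains agree just before it.\<close>

lemma jumps_nonempty:
  assumes "c \<in> Cseq n k" "\<And>j. j \<le> k \<Longrightarrow> cf n k b ! j \<le> c ! j" "c \<noteq> cf n k b"
  shows "jumps b c \<noteq> {}"
proof -
  have "\<exists>j. j \<le> k \<and> cf n k b ! j < c ! j"
    using Cseq_eqI[OF assms(1) cf_Cseq] assms(2,3) by (metis le_neq_implies_less)
  then obtain j where j: "j \<le> k \<and> cf n k b ! j < c ! j"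
    and least: "\<And>i. i < j \<Longrightarrow> \<not> (i \<le> k \<and> cf n k b ! i < c ! i)"
    using exists_least_iff[of "\<lambda>j. j \<le> k \<and> cf n k b ! j < c ! j"] by blast
  have "j \<noteq> 0"
    by (rule notI) (use j assms(1) cf_Cseq[of b] in \<open>simp add: Cseq_def\<close>)
  then have "c ! (j - 1) < cf n k b ! j"
    using least[of "j - 1"] j Cseq_lessI[OF cf_Cseq, of j b] by auto
  then have "j \<in> jumps b c" using j \<open>j \<noteq> 0\<close> by (auto simp: jumps_def)
  then show ?thesis by blast
qed

lemma Delta_ft_cf: "Delta k (ft n k 0 b) (cf n k b) = Delta k b (cf n k b)"
  using Delta_ft_above[OF cf_Cseq, of b b] by (simp add: jumps_def)

text \<open>Cutting a chain at a jump writes it as a superposition of two chains above \<open>cf\<close> with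
  fewer jumps, so that by exchange the excess over \<open>cf\<close> is additive; a chain with a single
  jump exceeds \<open>cf\<close> by at least one before, hence by at least zero after \<open>ft\<close>.\<close>

lemma Delta_ft_above_bound:
  assumes "c \<in> Cseq n k" "\<And>j. j \<le> k \<Longrightarrow> cf n k b ! j \<le> c ! j"
  shows "Delta k b (cf n k b) \<le> Delta k (ft n k 0 b) c \<and>
    (\<forall>l m. l \<le> k \<longrightarrow> cf n k b ! l \<le> m \<longrightarrow> m < c ! l \<longrightarrow>
      (\<exists>d\<in>Cseq n k. m < d ! l \<and> Delta k b d \<le> Delta k (ft n k 0 b) c + 1))"
  using assms
proof (induction "card (jumps b c)" arbitrary: c rule: less_induct)
  case less
  let ?f = "cf n k b"
  note c = less.prems
  have fin: "finite (jumps b c)" by (simp add: jumps_def)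
  consider "c = ?f" | j where "jumps b c = {j}" | i j where "i \<in> jumps b c" "j \<in> jumps b c" "i < j"
    using jumps_nonempty[OF c] by (metis ex_in_conv insertI1 is_singletonI' is_singleton_def linorder_neqE_nat)
  then show ?case
  proof cases
    case 1
    then show ?thesis by (auto simp: Delta_ft_cf)
  next
    case (2 j)
    then have "Delta k b ?f < Delta k b c"
      using Delta_cf_less[OF c(1), of j b] by (auto simp: jumps_def)
    moreover have "Delta k (ft n k 0 b) c = Delta k b c - 1"
      using Delta_ft_above[OF c] 2 by simp
    ultimately show ?thesis using c(1) by (auto intro!: bexI[of _ c])
  next
    case (3 i j)
    \<comment> \<open>Cut and reglue at \<open>j\<close>. The jump condition makes \<open>p\<close>
      a chain; \<open>q\<close> is one because \<open>cf ! (j - 1) < cf ! j < c ! j\<close>.\<close>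
    define p where "p = map (\<lambda>a. if a < j then c ! a else ?f ! a) [0..<Suc k]"
    define q where "q = map (\<lambda>a. if a < j then ?f ! a else c ! a) [0..<Suc k]"
    have p_nth: "p ! a = (if a < j then c ! a else ?f ! a)" if "a \<le> k" for a
      using that by (simp add: p_def nth_map del: upt_Suc)
    have q_nth: "q ! a = (if a < j then ?f ! a else c ! a)" if "a \<le> k" for a
      using that by (simp add: q_def nth_map del: upt_Suc)
    have j: "1 \<le> j" "j \<le> k" "c ! (j - 1) < ?f ! j" "?f ! j < c ! j"
      using 3(2) by (auto simp: jumps_def)
    have ends: "c ! 0 = 1" "?f ! 0 = 1" "c ! k = n + 1" "?f ! k = n + 1"
      using c(1) cf_Cseq[of b] by (simp_all add: Cseq_def)
    have less: "c ! (a - 1) < c ! a" "?f ! (a - 1) < ?f ! a" if "1 \<le> a" "a \<le> k" for a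
      using that Cseq_lessI c(1) cf_Cseq by blast+
    have pC: "p \<in> Cseq n k"
      unfolding p_def
    proof (rule CseqI)
      fix a assume a: "1 \<le> a" "a \<le> k"
      consider "a < j" | "a = j" | "j < a" by linarith
      then show "(if a - 1 < j then c ! (a - 1) else ?f ! (a - 1)) < (if a < j then c ! a else ?f ! a)"
        by cases (use j less[OF a] in auto)
    qed (use ends j in auto)
    have qC: "q \<in> Cseq n k"
      unfolding q_def
    proof (rule CseqI)
      fix a assume a: "1 \<le> a" "a \<le> k"
      consider "a < j" | "a = j" | "j < a" by linarith
      then show "(if a - 1 < j then ?f ! (a - 1) else c ! (a - 1)) < (if a < j then ?f ! a else c ! a)"
        by cases (use j less[OF a] in auto)
    qed (use ends j in auto)
    have above: "?f ! a \<le> p ! a" "?f ! a \<le> q ! a" if "a \<le> k" for a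
      using that c(2) by (auto simp: p_nth q_nth)
    have "jumps b p \<subseteq> jumps b c"
      using j by (auto simp: jumps_def p_nth split: if_splits)
    moreover have "jumps b q \<subseteq> jumps b c"
    proof
      fix a assume a: "a \<in> jumps b q"
      consider "a < j" | "a = j" | "j < a" by linarith
      then show "a \<in> jumps b c" by cases (use a 3(2) in \<open>auto simp: jumps_def q_nth split: if_splits\<close>)
    qed
    \<comment> \<open>\<open>q\<close> still jumps at \<open>j\<close>; its number of jumps goes
      down only because the earlier jump \<open>i\<close> is lost. This is why two jumps are needed
      to cut.\<close>
    moreover have "j \<notin> jumps b p" "i \<notin> jumps b q"
      using 3 j by (auto simp: jumps_def p_nth q_nth)
    ultimately have "jumps b p \<subset> jumps b c" "jumps b q \<subset> jumps b c" using 3 by auto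
    then have "card (jumps b p) < card (jumps b c)" "card (jumps b q) < card (jumps b c)"
      using fin by (simp_all add: psubset_card_mono)
    note IHp = less.hyps[OF this(1) pC above(1)] and IHq = less.hyps[OF this(2) qC above(2)]
    have ex: "Delta k (ft n k 0 b) p + Delta k (ft n k 0 b) q =
        Delta k (ft n k 0 b) c + Delta k b ?f"
      using Delta_exchange[OF pC qC c(1) cf_Cseq, of b "ft n k 0 b"]
      by (simp add: p_nth q_nth Delta_ft_cf)
    \<comment> \<open>The piece that follows \<open>c\<close> at position \<open>l\<close> supplies
      the witness. The other piece has at least the energy of \<open>cf\<close> after
      \<open>ft\<close>, so by \<open>ex\<close> the first one has at most that of
      \<open>c\<close>.\<close>
    have "\<exists>d\<in>Cseq n k. m < d ! l \<and> Delta k b d \<le> Delta k (ft n k 0 b) c + 1"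
      if l: "l \<le> k" "?f ! l \<le> m" "m < c ! l" for l m
    proof (cases "l < j")
      case True
      then have "m < p ! l" using l by (simp add: p_nth)
      then obtain d where "d \<in> Cseq n k" "m < d ! l" "Delta k b d \<le> Delta k (ft n k 0 b) p + 1"
        using IHp l by blast
      then show ?thesis using ex IHq by (intro bexI[of _ d]) auto
    next
      case False
      then have "m < q ! l" using l by (simp add: q_nth)
      then obtain d where "d \<in> Cseq n k" "m < d ! l" "Delta k b d \<le> Delta k (ft n k 0 b) q + 1"
        using IHq l by blast
      then show ?thesis using ex IHp by (intro bexI[of _ d]) auto
    qed
    then show ?thesis using ex IHp IHq by auto
  qed
qed

text \<open>After \<open>ft\<close>, \<open>cf\<close> still has least energy among the chains below
  it, in particular against the meet; modularity then gives the bound on the join.\<close>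

lemma Delta_ft_cjoin:
  assumes "c \<in> Cseq n k"
  shows "Delta k (ft n k 0 b) (cjoin k c (cf n k b)) \<le> Delta k (ft n k 0 b) c"
proof -
  let ?d = "cmeet k c (cf n k b)"
  have d: "?d \<in> Cseq n k" by (rule cmeet_Cseq[OF assms cf_Cseq])
  have "Delta k (ft n k 0 b) (cf n k b) \<le> Delta k (ft n k 0 b) ?d"
    using Delta_ft_below[OF d, of b] Delta_cf_le[OF d, of b] by (simp add: cmeet_nth Delta_ft_cf)
  then show ?thesis
    using Delta_modular[OF assms cf_Cseq, of "ft n k 0 b" b] by simp
qed

lemma Delta_cjoin:
  assumes "c \<in> Cseq n k"
  shows "Delta k b (cjoin k c (cf n k b)) \<le> Delta k b c"
  using Delta_modular[OF assms cf_Cseq, of b b] Delta_cf_le[OF cmeet_Cseq[OF assms cf_Cseq], of b b]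
  by simp

lemma Delta_ft_ge:
  assumes "c \<in> Cseq n k"
  shows "Delta k b (cf n k b) \<le> Delta k (ft n k 0 b) c"
  using Delta_ft_above_bound[OF cjoin_Cseq[OF assms cf_Cseq], of b b] Delta_ft_cjoin[OF assms, of b]
  by (force simp: cjoin_nth)

text \<open>Together with its converse below: if \<open>cf\<close> does not pass the threshold, the
  least energy of the chains that do falls by exactly one. The witness is in general not
  \<open>c\<close>, which may fall by more.\<close>

lemma Delta_ft_transfer_up:
  assumes "c \<in> Cseq n k" "l \<le> k" "cf n k b ! l \<le> m" "m < c ! l"
  shows "\<exists>d\<in>Cseq n k. m < d ! l \<and> Delta k b d \<le> Delta k (ft n k 0 b) c + 1"
proof -
  have "m < cjoin k c (cf n k b) ! l" using assms by (simp add: cjoin_nth)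
  then obtain d where "d \<in> Cseq n k" "m < d ! l"
    "Delta k b d \<le> Delta k (ft n k 0 b) (cjoin k c (cf n k b)) + 1"
    using Delta_ft_above_bound[OF cjoin_Cseq[OF assms(1) cf_Cseq], of b b] assms
    by (force simp: cjoin_nth)
  then show ?thesis using Delta_ft_cjoin[OF assms(1), of b] by (intro bexI[of _ d]) auto
qed

lemma Delta_ft_transfer_down:
  assumes "c \<in> Cseq n k" "l \<le> k" "cf n k b ! l \<le> m" "m < c ! l"
  shows "\<exists>d\<in>Cseq n k. m < d ! l \<and> Delta k (ft n k 0 b) d + 1 \<le> Delta k b c"
proof -
  let ?d = "cjoin k c (cf n k b)"
  have d: "?d \<in> Cseq n k" by (rule cjoin_Cseq[OF assms(1) cf_Cseq])
  have above: "cf n k b ! j \<le> ?d ! j" if "j \<le> k" for j using that by (simp add: cjoin_nth)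
  have m: "m < ?d ! l" using assms by (simp add: cjoin_nth)
  then have "?d \<noteq> cf n k b" using assms by auto
  then have "jumps b ?d \<noteq> {}" using jumps_nonempty[OF d above] by blast
  then have "card (jumps b ?d) \<noteq> 0" by (simp add: jumps_def)
  then have "Delta k (ft n k 0 b) ?d + 1 \<le> Delta k b ?d"
    using Delta_ft_above[OF d above] by simp
  then show ?thesis using Delta_cjoin[OF assms(1), of b] d m by (intro bexI[of _ ?d]) auto
qed

section \<open>Penalised minima for colour 0\<close>

definition MD :: "int \<Rightarrow> array \<Rightarrow> nat \<Rightarrow> nat \<Rightarrow> int" where
  "MD r b l m = (MIN c\<in>Cseq n k. Delta k b c + (if c ! l \<le> m then r else 0))"

lemma MD_ft:
  assumes "0 \<le> r" "l \<le> k"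
  shows "MD (r + 1) b l m = MD r (ft n k 0 b) l m + of_bool (cf n k b ! l \<le> m)"
  unfolding MD_def
proof (rule Min_image_shiftI[OF finite_Cseq Cseq_nonempty[OF k]])
  let ?f = "cf n k b" and ?b = "ft n k 0 b"
  fix c assume c: "c \<in> Cseq n k"
  note facts = assms c Delta_cf_le[OF c, of b] Delta_ft_ge[OF c, of b] Delta_ft_cf[of b]
  show "\<exists>d\<in>Cseq n k. Delta k b d + (if d ! l \<le> m then r + 1 else 0) \<le>
      Delta k ?b c + (if c ! l \<le> m then r else 0) + of_bool (?f ! l \<le> m)"
  \<comment> \<open>Only when the threshold separates \<open>cf\<close> from \<open>c\<close> are
    the transfer lemmas called for. Otherwise \<open>cf\<close> is the witness, being minimal with
    the same value before and after \<open>ft\<close>.\<close>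
  proof (cases "?f ! l \<le> m \<and> m < c ! l")
    case True
    then obtain d where "d \<in> Cseq n k" "m < d ! l" "Delta k b d \<le> Delta k ?b c + 1"
      using Delta_ft_transfer_up[OF c] assms(2) by blast
    then show ?thesis using True by (intro bexI[of _ d]) auto
  next
    case False
    then show ?thesis using facts by (intro bexI[OF _ cf_Cseq[of b]]) auto
  qed
  show "\<exists>d\<in>Cseq n k. Delta k ?b d + (if d ! l \<le> m then r else 0) + of_bool (?f ! l \<le> m) \<le>
      Delta k b c + (if c ! l \<le> m then r + 1 else 0)"
  proof (cases "?f ! l \<le> m \<and> m < c ! l")
    case True
    then obtain d where "d \<in> Cseq n k" "m < d ! l" "Delta k ?b d + 1 \<le> Delta k b c"
      using Delta_ft_transfer_down[OF c] assms(2) by blast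
    then show ?thesis using True by (intro bexI[of _ d]) auto
  next
    case False
    then show ?thesis using facts by (intro bexI[OF _ cf_Cseq[of b]]) auto
  qed
qed

text \<open>Row \<open>l\<close> gains a unit at \<open>cf ! (l - 1)\<close> and loses one at
  \<open>cf ! l\<close>. Writing each indicator of m = x as that of x <= m minus that of x <= m - 1
  gives the four terms.\<close>

definition shift0 :: "int \<Rightarrow> array \<Rightarrow> nat \<Rightarrow> nat \<Rightarrow> int" where
  "shift0 r b l m =
     MD r b (l - 1) m - MD r b l m + MD r b l (m - 1) - MD r b (l - 1) (m - 1)"

lemma ft_pow:
  assumes "l \<in> {1..k}" "1 \<le> m"
  shows "(ft n k 0 ^^ r) b l m = b l m + shift0 (int r) b l m"
proof (induction r arbitrary: b)
  case 0
  show ?case by (simp add: shift0_def MD_def)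
next
  case (Suc r)
  have of_bool: "of_bool (m = x) = of_bool (x \<le> m) - (of_bool (x \<le> m - 1) :: int)" for x
    using assms by auto
  have ft: "ft n k 0 b l m =
      b l m - of_bool (m = cf n k b ! l) + of_bool (m = cf n k b ! (l - 1))"
    using assms by (simp add: ft_def)
  have MD: "MD (int (Suc r)) b l' m' = MD (int r) (ft n k 0 b) l' m' + of_bool (cf n k b ! l' \<le> m')"
    if "l' \<le> k" for l' m'
    using MD_ft[of "int r" l' b m'] that by (simp add: add.commute)
  have "l \<le> k" "l - 1 \<le> k" using assms by auto
  then show ?case
    unfolding funpow_Suc_right comp_apply Suc shift0_def ft of_bool by (simp only: MD)
qed

text \<open>The symmetry of the Dynkin diagram fixing the node 0, which exchanges \<open>et\<close> and \<open>ft\<close>.\<close>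

definition flip :: "array \<Rightarrow> array" where
  "flip b j i = b (k + 1 - j) (n + 2 - i)"

definition cflip :: "nat list \<Rightarrow> nat list" where
  "cflip c = map (\<lambda>j. n + 2 - c ! (k - j)) [0..<Suc k]"

lemma cflip_nth: "j \<le> k \<Longrightarrow> cflip c ! j = n + 2 - c ! (k - j)"
  by (simp add: cflip_def nth_map del: upt_Suc)

lemma cflip_Cseq:
  assumes "c \<in> Cseq n k"
  shows "cflip c \<in> Cseq n k"
  unfolding cflip_def
proof (rule CseqI)
  fix j assume j: "1 \<le> j" "j \<le> k"
  then have "c ! (k - j) < c ! (k - (j - 1))"
    using Cseq_lessI[OF assms, of "k - j + 1"] by (simp add: Suc_diff_le)
  then show "n + 2 - c ! (k - (j - 1)) < n + 2 - c ! (k - j)"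
    using Cseq_bounds(2)[OF assms, of "k - (j - 1)", OF diff_le_self] by linarith
qed (use assms in \<open>auto simp: Cseq_def\<close>)

lemma cflip_cflip: "c \<in> Cseq n k \<Longrightarrow> cflip (cflip c) = c"
proof (rule Cseq_eqI)
  assume c: "c \<in> Cseq n k"
  then show "c \<in> Cseq n k" "cflip (cflip c) \<in> Cseq n k" by (simp_all add: cflip_Cseq)
  fix j assume "j \<le> k"
  then show "cflip (cflip c) ! j = c ! j" using Cseq_bounds[OF c, of j] by (simp add: cflip_nth)
qed

lemma Delta_flip:
  assumes "c \<in> Cseq n k"
  shows "Delta k (flip b) (cflip c) = Delta k b c"
  unfolding Delta_def
proof (rule sum.reindex_bij_witness[of _ "\<lambda>j. k + 1 - j" "\<lambda>j. k + 1 - j"])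
  fix j assume j: "j \<in> {1..k}"
  then have e: "k - (k + 1 - j) = j - 1" "k + 1 - j - 1 = k - j"
    "k - (j - 1) = k + 1 - j" by auto
  have bd: "c ! (k + 1 - j) \<le> n + 1" "1 \<le> c ! (k - j)" 
    using Cseq_bounds[OF assms] j by auto
  show "(\<Sum>i\<in>{c ! (k + 1 - j - 1)<..<c ! (k + 1 - j)}. b (k + 1 - j) i) =
        (\<Sum>i\<in>{cflip c ! (j - 1)<..<cflip c ! j}. flip b j i)"
    using j bd unfolding e
    by (intro sum.reindex_bij_witness[of _ "\<lambda>i. n + 2 - i" "\<lambda>i. n + 2 - i"])
      (auto simp: flip_def cflip_nth e)
qed auto

lemma preceq_cflip:
  assumes "c \<in> Cseq n k" "d \<in> Cseq n k"
  shows "preceq (cflip c) (cflip d) \<longleftrightarrow> preceq d c"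
proof -
  have "cflip c ! j \<le> cflip d ! j \<longleftrightarrow> d ! (k - j) \<le> c ! (k - j)" if "j \<le> k" for j
    unfolding cflip_nth[OF that]
    using Cseq_bounds(2)[OF assms(1), of "k - j", OF diff_le_self]
      Cseq_bounds(2)[OF assms(2), of "k - j", OF diff_le_self] by linarith
  then have "preceq (cflip c) (cflip d) \<longleftrightarrow> (\<forall>j\<le>k. d ! (k - j) \<le> c ! (k - j))"
    unfolding preceq_Cseq[OF assms[THEN cflip_Cseq]] by blast
  also have "\<dots> \<longleftrightarrow> (\<forall>j\<le>k. d ! j \<le> c ! j)"
    by (metis diff_diff_cancel diff_le_self)
  finally show ?thesis
    unfolding preceq_Cseq[OF assms(2,1)] .
qed

text \<open>Reflection reverses the order of chains, so the greatest minimiser for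
  \<open>flip b\<close> reflects to the least one for \<open>b\<close>. This also yields the
  existence of \<open>ce\<close>.\<close>

lemma cf_flip: "cf n k (flip b) = cflip (ce n k b)" and ce_Cseq: "ce n k b \<in> Cseq n k"
proof -
  define f where "f = cf n k (flip b)"
  have f: "is_cf n k (flip b) f" "f \<in> Cseq n k"
    using is_cf_cf cf_Cseq by (simp_all add: f_def)
  have "is_ce n k b (cflip f)"
    unfolding is_ce_def
  proof (intro conjI ballI)
    show "cflip f \<in> Cseq n k" using f(2) by (rule cflip_Cseq)
    fix d assume d: "d \<in> Cseq n k"
    have "Delta k b (cflip f) = Delta k (flip b) f"
      using Delta_flip[OF cflip_Cseq[OF f(2)], of b] by (simp add: cflip_cflip f(2))
    moreover have "preceq (cflip f) d \<longleftrightarrow> preceq (cflip d) f"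
      using preceq_cflip[OF f(2) cflip_Cseq[OF d]] by (simp add: cflip_cflip d)
    moreover have "(preceq (cflip d) f \<longrightarrow> Delta k (flip b) f \<le> Delta k b d) \<and>
        (\<not> preceq (cflip d) f \<longrightarrow> Delta k (flip b) f < Delta k b d)"
      using f(1) cflip_Cseq[OF d] Delta_flip[OF d, of b] unfolding is_cf_def by metis
    ultimately show "preceq (cflip f) d \<longrightarrow> Delta k b (cflip f) \<le> Delta k b d"
      "\<not> preceq (cflip f) d \<longrightarrow> Delta k b (cflip f) < Delta k b d" by auto
  qed
  then have "ce n k b = cflip f" by (rule ce_eqI)
  then show "cf n k (flip b) = cflip (ce n k b)" "ce n k b \<in> Cseq n k"
    using f(2) by (simp_all add: cflip_cflip cflip_Cseq f_def)
qed

text \<open>Both are minimisers, so their energies cancel in wt_0, leaving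
  \<open>b k (n + 1) - b 1 1\<close>.\<close>

lemma Delta_ce: "Delta k b (ce n k b) = Delta k b (cf n k b)"
proof (rule antisym)
  have "Delta k b (ce n k b) = Delta k (flip b) (cf n k (flip b))"
    by (simp add: cf_flip Delta_flip ce_Cseq)
  also have "\<dots> \<le> Delta k (flip b) (cflip (cf n k b))"
    by (rule Delta_cf_le) (rule cflip_Cseq[OF cf_Cseq])
  also have "\<dots> = Delta k b (cf n k b)" by (rule Delta_flip[OF cf_Cseq])
  finally show "Delta k b (ce n k b) \<le> Delta k b (cf n k b)" .
qed (rule Delta_cf_le[OF ce_Cseq])

lemma flip_et: "flip (et n k 0 b) = ft n k 0 (flip b)"
proof (intro ext)
  fix j i
  let ?e = "ce n k b"
  have *: "n + 2 - i = ?e ! a \<longleftrightarrow> i = n + 2 - ?e ! a" if "a \<le> k" for a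
    using Cseq_bounds[OF ce_Cseq that, of b] by auto
  show "flip (et n k 0 b) j i = ft n k 0 (flip b) j i"
  proof (cases "j \<in> {1..k}")
    case True
    then have idx: "k + 1 - j \<in> {1..k}" "k + 1 - j - 1 = k - j" "k - (j - 1) = k + 1 - j"
      "j \<le> k" "j - 1 \<le> k" by auto
    have "n + 2 - i = ?e ! (k + 1 - j - 1) \<longleftrightarrow> i = cflip ?e ! j"
      "n + 2 - i = ?e ! (k + 1 - j) \<longleftrightarrow> i = cflip ?e ! (j - 1)"
      using idx(1) by (simp_all only: * cflip_nth idx diff_le_self atLeastAtMost_iff)
    then show ?thesis
      unfolding flip_def et_def ft_def cf_flip using True idx(1) by (simp only: if_True refl)
  next
    case False
    then have "k + 1 - j \<notin> {1..k}" by auto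
    with False show ?thesis
      unfolding flip_def et_def ft_def by (simp only: if_False if_True refl)
  qed
qed

lemma flip_et_pow: "flip ((et n k 0 ^^ r) b) = (ft n k 0 ^^ r) (flip b)"
  by (induction r) (simp_all add: flip_et)

text \<open>Reflection sends the penalised chains to the complement of a threshold set. A penalty r
  on the complement is a penalty -r on the set plus a global r, and this constant cancels in
  \<open>shift0\<close>.\<close>

lemma MD_flip:
  assumes "l \<le> k" "m \<le> n + 1"
  shows "MD r (flip b) l m = MD (- r) b (k - l) (n + 1 - m) + r"
  unfolding MD_def
proof (rule Min_image_shiftI[OF finite_Cseq Cseq_nonempty[OF k]])
  have eq: "Delta k (flip b) (cflip c) + (if cflip c ! l \<le> m then r else 0) =
      Delta k b c + (if c ! (k - l) \<le> n + 1 - m then - r else 0) + r"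
    if "c \<in> Cseq n k" for c
    using that assms Cseq_bounds[OF that, of "k - l"] by (auto simp: Delta_flip cflip_nth)
  fix c assume c: "c \<in> Cseq n k"
  show "\<exists>d\<in>Cseq n k. Delta k (flip b) d + (if d ! l \<le> m then r else 0) \<le>
      Delta k b c + (if c ! (k - l) \<le> n + 1 - m then - r else 0) + r"
    using eq[OF c] cflip_Cseq[OF c] by (intro bexI[of _ "cflip c"]) auto
  show "\<exists>d\<in>Cseq n k. Delta k b d + (if d ! (k - l) \<le> n + 1 - m then - r else 0) + r \<le>
      Delta k (flip b) c + (if c ! l \<le> m then r else 0)"
    using eq[OF cflip_Cseq[OF c]] cflip_Cseq[OF c]
    by (intro bexI[of _ "cflip c"]) (simp_all add: cflip_cflip c)
qed

lemma et_pow: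
  assumes "l \<in> {1..k}" "m \<in> {1..n + 1}"
  shows "(et n k 0 ^^ r) b l m = b l m + shift0 (- int r) b l m"
proof -
  have e: "k - (k - l) = l" "k - (k + 1 - l) = l - 1" "n + 1 - (n + 2 - m) = m - 1"
    "n + 1 - (n + 2 - m - 1) = m" "k + 1 - (k + 1 - l) = l" "n + 2 - (n + 2 - m) = m"
    "k + 1 - l - 1 = k - l"
    using assms by auto
  have "(et n k 0 ^^ r) b l m = flip ((et n k 0 ^^ r) b) (k + 1 - l) (n + 2 - m)"
    by (simp only: flip_def e)
  also have "\<dots> = flip b (k + 1 - l) (n + 2 - m) + shift0 (int r) (flip b) (k + 1 - l) (n + 2 - m)"
    unfolding flip_et_pow using assms by (intro ft_pow) auto
  \<comment> \<open>Reflection interchanges \<open>l\<close> with \<open>l - 1\<close> and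
    \<open>m\<close> with \<open>m - 1\<close>; \<open>shift0\<close> is invariant under doing
    both.\<close>
  also have "shift0 (int r) (flip b) (k + 1 - l) (n + 2 - m) = shift0 (- int r) b l m"
  proof -
    have "k + 1 - l \<le> k" "k - l \<le> k" "n + 2 - m \<le> n + 1" "n + 2 - m - 1 \<le> n + 1"
      using assms by auto
    then show ?thesis by (simp only: shift0_def e MD_flip)
  qed
  finally show ?thesis by (simp only: flip_def e)
qed

section \<open>The reflection of colour 0\<close>

lemma st_eq:
  assumes "l \<in> {1..k}" "m \<in> {1..n + 1}"
  shows "st n k 0 b l m = b l m + shift0 (wt n k 0 b) b l m"
proof (cases "0 \<le> - wt n k 0 b")
  case True
  then show ?thesis
    using et_pow[OF assms, of "nat (- wt n k 0 b)" b] by (simp add: st_def et_pow_def)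
next
  case False
  then show ?thesis
    using ft_pow[of l m "nat (wt n k 0 b)" b] assms by (simp add: st_def et_pow_def)
qed

text \<open>At r = wt_0 the penalty in \<open>MD\<close> is the difference of \<open>Deltak\<close>
  and \<open>Delta1\<close>. The constant \<open>b 1 1\<close> is common to the four minima of the
  formula and cancels there.\<close>

lemma min_minover_MD:
  assumes "\<And>x. Q x \<longleftrightarrow> m < x" "\<And>x. R x \<longleftrightarrow> x \<le> m"
  shows "min (minover {c \<in> Cseq n k. Q (c ! l)} (Delta1 k b))
             (minover {c \<in> Cseq n k. R (c ! l)} (Deltak n k b)) =
         ext (MD (wt n k 0 b) b l m + b 1 1)"
proof -
  have "wt n k 0 b = b k (n + 1) - b 1 1" by (simp add: wt_def phi_def eps_def Delta_ce)
  then have "(MIN c\<in>Cseq n k. if Q (c ! l) then Delta1 k b c else Deltak n k b c) =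
      MD (wt n k 0 b) b l m + b 1 1"
    unfolding MD_def
    by (intro Min_image_shiftI[OF finite_Cseq Cseq_nonempty[OF k]])
      (erule bexI[rotated], auto simp: Delta1_def Deltak_def assms)+
  moreover have "min (minover {c \<in> Cseq n k. Q (c ! l)} (Delta1 k b))
      (minover {c \<in> Cseq n k. R (c ! l)} (Deltak n k b)) =
      ext (MIN c\<in>Cseq n k. if Q (c ! l) then Delta1 k b c else Deltak n k b c)"
    by (rule min_minover[OF finite_Cseq Cseq_nonempty[OF k]]) (simp add: assms not_less)
  ultimately show ?thesis by simp
qed

lemma ext_st:
  assumes "l \<in> {1..k}" "m \<in> {1..n + 1}"
  shows "ext (st n k 0 b l m) =
          ext (b l m)
          + min (minover {c \<in> Cseq n k. c ! (l - 1) > m} (Delta1 k b))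
                (minover {c \<in> Cseq n k. c ! (l - 1) \<le> m} (Deltak n k b))
          - min (minover {c \<in> Cseq n k. c ! l > m} (Delta1 k b))
                (minover {c \<in> Cseq n k. c ! l \<le> m} (Deltak n k b))
          + min (minover {c \<in> Cseq n k. c ! l \<ge> m} (Delta1 k b))
                (minover {c \<in> Cseq n k. c ! l < m} (Deltak n k b))
          - min (minover {c \<in> Cseq n k. c ! (l - 1) \<ge> m} (Delta1 k b))
                (minover {c \<in> Cseq n k. c ! (l - 1) < m} (Deltak n k b))"
proof -
  have "m \<le> x \<longleftrightarrow> m - 1 < x" "x < m \<longleftrightarrow> x \<le> m - 1" for x using assms by auto
  note min_minover_MD[of "\<lambda>x. m \<le> x" "m - 1" "\<lambda>x. x < m", OF this]
    min_minover_MD[of "\<lambda>x. m < x" m "\<lambda>x. x \<le> m", OF refl refl]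
  then show ?thesis
    by (simp only: st_eq[OF assms] shift0_def ext_arith) (simp add: algebra_simps)
qed

end

theorem theorem8p4:
  fixes n k :: nat and b :: array
  assumes "n \<ge> 2" and "1 \<le> k" and "k \<le> n" and "b \<in> Binf n k"
  shows
    "(\<forall>i\<in>{1..n}. \<forall>l\<in>{1..k}. \<forall>m\<in>{l..l + kc n k}.
        ext (st n k i b l m) =
          ext (b l m) + ext (of_bool (i = m - 1) - of_bool (i = m)) *
            (min (minover {p \<in> {beta n k i + 1..gam k i}. l + 1 \<le> p} (\<lambda>p. - GamR k i b p))
                 (minover {p \<in> {beta n k i + 1..gam k i}. p \<le> l} (GamL n k i b))
             - min (minover {p \<in> {beta n k i + 1..gam k i}. l \<le> p} (\<lambda>p. - GamR k i b p))
                   (minover {p \<in> {beta n k i + 1..gam k i}. p \<le> l - 1} (GamL n k i b)))) \<and>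
     (\<forall>l\<in>{1..k}. \<forall>m\<in>{l..l + kc n k}.
        ext (st n k 0 b l m) =
          ext (b l m)
          + min (minover {c \<in> Cseq n k. c ! (l - 1) > m} (Delta1 k b))
                (minover {c \<in> Cseq n k. c ! (l - 1) \<le> m} (Deltak n k b))
          - min (minover {c \<in> Cseq n k. c ! l > m} (Delta1 k b))
                (minover {c \<in> Cseq n k. c ! l \<le> m} (Deltak n k b))
          + min (minover {c \<in> Cseq n k. c ! l \<ge> m} (Delta1 k b))
                (minover {c \<in> Cseq n k. c ! l < m} (Deltak n k b))
          - min (minover {c \<in> Cseq n k. c ! (l - 1) \<ge> m} (Delta1 k b))
                (minover {c \<in> Cseq n k. c ! (l - 1) < m} (Deltak n k b)))"
proof (intro conjI ballI, goal_cases)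
  case (1 i l m)
  then interpret colour n k i using assms by unfold_locales auto
  show ?case using 1 by (intro ext_st) auto
next
  case (2 l m)
  interpret colour0 n k using assms by unfold_locales auto
  show ?case using 2 assms(3) by (intro ext_st) (auto simp: kc_def)
qed

end
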